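(* Let $d\ge1$, let $\mathcal F=\{f_1,\dots,f_m\}$ be a set of vectors in $\mathbb C^d$ and let $F=[f_1,\dots,f_m]\in\mathbb C^{d\times m}$ be the associated frame matrix. The following properties are equivalent: (A) $F$ is phase retrievable on $\mathbb C^d$. (B) For any partition $S_1,\dots,S_p$ of $\{1,\dots,m\}$, there exist no $\eta_j\in\mathcal N(F_{S_j})\setminus\{0\}$, $j=1,\dots,p$, such that $$\frac{\eta_1-\eta_\ell}{c_1-c_\ell}=\frac{\eta_1-\eta_j}{c_1-c_j}\neq 0\quad\text{for all } \ell,j\in\{2,\dots,p\}$$ for some pairwise distinct $c_1,\dots,c_p\in\mathbb S$.
   Context: $\mathbb S=\{c\in\mathbb C:|c|=1\}$. The convention is $\langle f_j,x\rangle=f_j^\top x$, so that $F^\top x=[\langle f_1,x\rangle,\dots,\langle f_m,x\rangle]^\top$. $F$ (or $\mathcal F$) is phase retrievable on $\mathbb C^d$ if, for all $x,y\in\mathbb C^d$, the equalities $|\langle f_j,x\rangle|=|\langle f_j,y\rangle|$ for $j=1,\dots,m$ imply $x=cy$ for some $c\in\mathbb S$. For $S\subseteq\{1,\dots,m\}$, $F_S$ is the matrix whose columns are the $f_j$, $j\in S$, and $\mathcal N(F_S)=\{\eta\in\mathbb C^d:\langle f_j,\eta\rangle=0\text{ for all } j\in S\}$ (the kernel of $F_S^\top$), with $\mathcal N(F_\emptyset)=\mathbb C^d$. A partition $S_1,\dots,S_p$ of $\{1,\dots,m\}$ ($p$ a positive integer) means subsets $S_j\subseteq\{1,\dots,m\}$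 that are pairwise disjoint with union $\{1,\dots,m\}$; members $S_j$ are allowed to be empty. *)

theory Defs
  imports Complex_Main "HOL-Library.Disjoint_Sets" "Jordan_Normal_Form.Matrix"
begin

text \<open>The frame vectors are the columns of \<open>F\<close>, indexed from \<open>0\<close>. The pairing is the bilinear
  \<^const>\<open>scalar_prod\<close>, with no complex conjugation.\<close>

definition phase_retrievable :: "complex mat \<Rightarrow> bool" where
  "phase_retrievable F \<longleftrightarrow>
    (\<forall>x \<in> carrier_vec (dim_row F). \<forall>y \<in> carrier_vec (dim_row F).
      (\<forall>j < dim_col F. cmod (col F j \<bullet> x) = cmod (col F j \<bullet> y)) \<longrightarrow>
      (\<exists>c. cmod c = 1 \<and> x = c \<cdot>\<^sub>v y))"

text \<open>For \<open>S \<subseteq> {0..<dim_col F}\<close> this is the kernel of the transpose of the matrix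
  formed by the columns of \<open>F\<close> with index in \<open>S\<close>; for empty \<open>S\<close> it is the whole space.\<close>

definition null_space :: "complex mat \<Rightarrow> nat set \<Rightarrow> complex vec set" where
  "null_space F S = {\<eta> \<in> carrier_vec (dim_row F). \<forall>j \<in> S. col F j \<bullet> \<eta> = 0}"

text \<open>The members \<open>S 1, \<dots>, S p\<close> may be empty.\<close>

definition indexed_partition :: "nat \<Rightarrow> (nat \<Rightarrow> nat set) \<Rightarrow> nat set \<Rightarrow> bool" where
  "indexed_partition p S A \<longleftrightarrow>
    (\<Union>k \<in> {1..p}. S k) = A \<and> disjoint_family_on S {1..p}"

end

theory Submission
  imports Defs
begin

text \<open>Vectors \<open>x\<close> and \<open>y\<close> have measurements of equal modulus iff for every \<open>k\<close> there is a unimodular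
  \<open>a\<^sub>k\<close> with \<open>\<langle>f\<^sub>k, x\<rangle> + a\<^sub>k \<langle>f\<^sub>k, y\<rangle> = 0\<close>. Grouping the indices by the value \<open>c\<^sub>j\<close> of \<open>a\<^sub>k\<close> gives a partition with
  \<open>\<eta>\<^sub>j = x + c\<^sub>j y\<close> in the kernel belonging to the \<open>j\<close>-th block. Conversely, the condition on the \<open>\<eta>\<^sub>j\<close> says
  precisely that they lie on such a line, with \<open>y\<close> the common quotient and \<open>x = \<eta>\<^sub>1 - c\<^sub>1 y\<close>.\<close>

text \<open>The vectors \<open>v\<close> and \<open>0\<close> have the same measurements, so
  \<open>v\<close> is a unimodular multiple of \<open>0\<close>.\<close>

lemma phase_retrievable_null_vector:
  assumes "phase_retrievable F" "v \<in> carrier_vec (dim_row F)"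
    and "\<And>k. k < dim_col F \<Longrightarrow> col F k \<bullet> v = 0"
  shows "v = 0\<^sub>v (dim_row F)"
proof -
  have "cmod (col F k \<bullet> v) = cmod (col F k \<bullet> 0\<^sub>v (dim_row F))" if "k < dim_col F" for k
    using assms(3)[OF that] by (simp add: carrier_vecI)
  then obtain c where "v = c \<cdot>\<^sub>v 0\<^sub>v (dim_row F)"
    using assms(1,2) unfolding phase_retrievable_def by (meson zero_carrier_vec)
  then show ?thesis by auto
qed

text \<open>The vanishing measurements force \<open>w\<close> and \<open>v\<close> to have
  measurements of equal modulus, so \<open>w\<close> is a multiple \<open>c\<close> of
  \<open>v\<close>. Every point \<open>w + a v\<close> is then \<open>(c + a) v\<close>, and where
  this point is nonzero, a measurement that kills it kills \<open>v\<close> as well. All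
  measurements of \<open>v\<close> therefore vanish, against \<open>v0\<close>.\<close>

lemma phase_retrievable_no_kernel_line:
  assumes pr: "phase_retrievable F"
    and w: "w \<in> carrier_vec (dim_row F)" and v: "v \<in> carrier_vec (dim_row F)"
    and v0: "v \<noteq> 0\<^sub>v (dim_row F)"
    and zero: "\<And>k. k < dim_col F \<Longrightarrow>
      \<exists>a. cmod a = 1 \<and> w + a \<cdot>\<^sub>v v \<noteq> 0\<^sub>v (dim_row F) \<and> col F k \<bullet> (w + a \<cdot>\<^sub>v v) = 0"
  shows False
proof -
  have col: "col F k \<in> carrier_vec (dim_row F)" for k by (simp add: carrier_vecI)
  have sp: "col F k \<bullet> (w + a \<cdot>\<^sub>v v) = col F k \<bullet> w + a * (col F k \<bullet> v)" for k a
    using w v col[of k] by (simp add: scalar_prod_add_distrib[where n = "dim_row F"])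
  have "cmod (col F k \<bullet> w) = cmod (col F k \<bullet> v)" if k: "k < dim_col F" for k
  proof -
    obtain a where a: "cmod a = 1" "col F k \<bullet> (w + a \<cdot>\<^sub>v v) = 0"
      using zero[OF k] by blast
    then have "col F k \<bullet> w = - (a * (col F k \<bullet> v))"
      using sp by (simp add: eq_neg_iff_add_eq_0)
    then show ?thesis using a(1) by (simp add: norm_mult)
  qed
  then obtain c where c: "w = c \<cdot>\<^sub>v v"
    using pr w v unfolding phase_retrievable_def by blast
  have "col F k \<bullet> v = 0" if k: "k < dim_col F" for k
  proof -
    obtain a where a: "w + a \<cdot>\<^sub>v v \<noteq> 0\<^sub>v (dim_row F)" "col F k \<bullet> (w + a \<cdot>\<^sub>v v) = 0"
      using zero[OF k] by blast
    have eq: "w + a \<cdot>\<^sub>v v = (c + a) \<cdot>\<^sub>v v"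
      by (simp add: c add_smult_distrib_vec)
    have "c + a \<noteq> 0"
      using a(1) v unfolding eq by auto
    then show ?thesis
      using a(2) v col[of k] unfolding eq by simp
  qed
  then show False
    using phase_retrievable_null_vector[OF pr v] v0 by blast
qed

lemma phase_retrievable_imp_partition_condition:
  assumes pr: "phase_retrievable F"
    and p: "p \<ge> 1" and part: "indexed_partition p S {0..<dim_col F}"
    and \<eta>: "\<forall>j \<in> {1..p}. \<eta> j \<in> null_space F (S j) - {0\<^sub>v (dim_row F)}"
    and c: "\<forall>j \<in> {1..p}. cmod (c j) = 1" "inj_on c {1..p}"
    and line: "\<forall>l \<in> {2..p}. \<forall>j \<in> {2..p}.
       (1 / (c 1 - c l)) \<cdot>\<^sub>v (\<eta> 1 - \<eta> l) = (1 / (c 1 - c j)) \<cdot>\<^sub>v (\<eta> 1 - \<eta> j) \<and>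
       (1 / (c 1 - c j)) \<cdot>\<^sub>v (\<eta> 1 - \<eta> j) \<noteq> 0\<^sub>v (dim_row F)"
  shows False
proof -
  have \<eta>c: "\<eta> j \<in> carrier_vec (dim_row F)" if "j \<in> {1..p}" for j
    using bspec[OF \<eta> that] by (simp add: null_space_def)
  have block: "\<exists>j \<in> {1..p}. k \<in> S j" if "k < dim_col F" for k
  proof -
    have "k \<in> (\<Union>j \<in> {1..p}. S j)"
      using part that by (simp add: indexed_partition_def)
    then show ?thesis by blast
  qed
  show False
  proof (cases "p = 1")
    \<comment> \<open>With a single block, \<open>line\<close> is vacuous and there is no quotient
      to serve as direction. The block \<open>S 1\<close> contains every index, so
      \<open>\<eta> 1\<close> is annihilated by all frame vectors.\<close>
    case True
    have "col F k \<bullet> \<eta> 1 = 0" if "k < dim_col F" for k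
      using block[OF that] bspec[OF \<eta>, of 1] True by (auto simp: null_space_def)
    then have "\<eta> 1 = 0\<^sub>v (dim_row F)"
      using phase_retrievable_null_vector[OF pr \<eta>c[of 1]] True by simp
    then show False using bspec[OF \<eta>, of 1] True by simp
  next
    case False
    then have p2: "2 \<in> {2..p}" using p by auto
    define v where "v = (1 / (c 1 - c 2)) \<cdot>\<^sub>v (\<eta> 1 - \<eta> 2)"
    define w where "w = \<eta> 1 - c 1 \<cdot>\<^sub>v v"
    have \<eta>1: "\<eta> 1 \<in> carrier_vec (dim_row F)" using \<eta>c p by simp
    have v: "v \<in> carrier_vec (dim_row F)"
      using \<eta>c[of 2] p2 \<eta>1 unfolding v_def by simp
    have v0: "v \<noteq> 0\<^sub>v (dim_row F)"
      unfolding v_def using bspec[OF bspec[OF line p2] p2] by blast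
    have w: "w \<in> carrier_vec (dim_row F)"
      using \<eta>1 v unfolding w_def by simp
    have on_line: "w + c j \<cdot>\<^sub>v v = \<eta> j" if j: "j \<in> {1..p}" for j
    proof (cases "j = 1")
      case True
      then show ?thesis
        using \<eta>1 v unfolding w_def by (intro eq_vecI) auto
    next
      case False
      then have j2: "j \<in> {2..p}" using j by auto
      have ne: "c 1 - c j \<noteq> 0"
        using inj_onD[OF c(2), of 1 j] j False p by auto
      have vj: "v = (1 / (c 1 - c j)) \<cdot>\<^sub>v (\<eta> 1 - \<eta> j)"
        \<comment> \<open>The quotient for index 2 was chosen as direction; \<open>line\<close> with
          \<open>l = 2\<close> identifies it with the quotient for \<open>j\<close>.\<close>
        unfolding v_def using bspec[OF bspec[OF line p2] j2] by blast
      have "(c 1 - c j) * v $ i = \<eta> 1 $ i - \<eta> j $ i" if "i < dim_row F" for i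
        using ne that \<eta>1 \<eta>c[OF j] by (subst vj) simp
      then show ?thesis
        using \<eta>1 v \<eta>c[OF j] unfolding w_def
        by (intro eq_vecI) (auto simp: algebra_simps)
    qed
    show False
    proof (rule phase_retrievable_no_kernel_line[OF pr w v v0])
      fix k assume "k < dim_col F"
      then obtain j where j: "j \<in> {1..p}" "k \<in> S j" using block by blast
      then show "\<exists>a. cmod a = 1 \<and> w + a \<cdot>\<^sub>v v \<noteq> 0\<^sub>v (dim_row F) \<and> col F k \<bullet> (w + a \<cdot>\<^sub>v v) = 0"
        using bspec[OF \<eta> j(1)] bspec[OF c(1) j(1)] on_line[OF j(1)]
        by (intro exI[of _ "c j"]) (simp add: null_space_def)
    qed
  qed
qed

text \<open>Injectivity of \<open>c\<close> makes the level sets of \<open>a\<close> disjoint, and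
  surjectivity makes them cover \<open>A\<close>. The extra value \<open>b\<close> need not be
  attained by \<open>a\<close>; its level set is then empty.\<close>

lemma indexed_partition_level_sets:
  assumes "bij_betw c {1..p} (insert b (a ` A))"
  shows "indexed_partition p (\<lambda>j. {k \<in> A. a k = c j}) A"
  unfolding indexed_partition_def
proof
  have "\<exists>j \<in> {1..p}. a k = c j" if "k \<in> A" for k
  proof -
    have "a k \<in> c ` {1..p}"
      unfolding bij_betw_imp_surj_on[OF assms] using that by simp
    then show ?thesis by blast
  qed
  then show "(\<Union>j \<in> {1..p}. {k \<in> A. a k = c j}) = A" by blast
  show "disjoint_family_on (\<lambda>j. {k \<in> A. a k = c j}) {1..p}"
    unfolding disjoint_family_on_def
    using inj_onD[OF bij_betw_imp_inj_on[OF assms]] by fastforce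
qed

lemma not_phase_retrievable_imp_partition:
  assumes "\<not> phase_retrievable F"
  shows "\<exists>p S \<eta> c. p \<ge> 1 \<and> indexed_partition p S {0..<dim_col F} \<and>
    (\<forall>j \<in> {1..p}. \<eta> j \<in> null_space F (S j) - {0\<^sub>v (dim_row F)}) \<and>
    (\<forall>j \<in> {1..p}. cmod (c j) = 1) \<and> inj_on c {1..p} \<and>
    (\<forall>l \<in> {2..p}. \<forall>j \<in> {2..p}.
       (1 / (c 1 - c l)) \<cdot>\<^sub>v (\<eta> 1 - \<eta> l) = (1 / (c 1 - c j)) \<cdot>\<^sub>v (\<eta> 1 - \<eta> j) \<and>
       (1 / (c 1 - c j)) \<cdot>\<^sub>v (\<eta> 1 - \<eta> j) \<noteq> 0\<^sub>v (dim_row F))"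
proof -
  obtain x y where x: "x \<in> carrier_vec (dim_row F)" and y: "y \<in> carrier_vec (dim_row F)"
    and eq: "\<And>k. k < dim_col F \<Longrightarrow> cmod (col F k \<bullet> x) = cmod (col F k \<bullet> y)"
    and ne: "\<And>c. cmod c = 1 \<Longrightarrow> x \<noteq> c \<cdot>\<^sub>v y"
    using assms unfolding phase_retrievable_def by blast
  have col: "col F k \<in> carrier_vec (dim_row F)" for k by (simp add: carrier_vecI)
  show ?thesis
  proof (cases "y = 0\<^sub>v (dim_row F)")
    \<comment> \<open>A line with direction \<open>y = 0\<close> would have zero quotients. Instead,
      all measurements of \<open>x\<close> vanish, and a single block with \<open>x\<close> as its
      kernel vector violates the condition, since the range \<open>{2..p}\<close> is empty for
      \<open>p = 1\<close>.\<close>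
    case True
    have "x \<noteq> 0\<^sub>v (dim_row F)" using ne[of 1] True by auto
    moreover have "col F k \<bullet> x = 0" if "k < dim_col F" for k
      using eq[OF that] True col[of k] by simp
    ultimately have "x \<in> null_space F {0..<dim_col F} - {0\<^sub>v (dim_row F)}"
      using x unfolding null_space_def by simp
    then show ?thesis
      by (intro exI[of _ 1] exI[of _ "\<lambda>_. {0..<dim_col F}"] exI[of _ "\<lambda>_. x"] exI[of _ "\<lambda>_. 1"])
        (auto simp: indexed_partition_def disjoint_family_on_def)
  next
    case y0: False
    \<comment> \<open>If the measurement of \<open>y\<close> vanishes, so does that of
      \<open>x\<close> by \<open>eq\<close>, and any unimodular value would do; 1 is the
      default.\<close>
    define a where "a k = (if col F k \<bullet> y = 0 then 1 else - (col F k \<bullet> x) / (col F k \<bullet> y))" for k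
    have a: "cmod (a k) = 1" "col F k \<bullet> x + a k * (col F k \<bullet> y) = 0" if "k < dim_col F" for k
      using eq[OF that] by (auto simp: a_def norm_divide)
    \<comment> \<open>The value \<open>1\<close> is added so that there is a block, possibly empty, even if there are no frame vectors.\<close>
    define C where "C = insert 1 (a ` {0..<dim_col F})"
    define p where "p = card C"
    have "finite C" by (simp add: C_def)
    then obtain c where c: "bij_betw c {1..p} C"
      using ex_bij_betw_nat_finite_1 p_def by blast
    have "p \<ge> 1" using \<open>finite C\<close> by (simp add: p_def C_def card_gt_0_iff Suc_le_eq)
    have norm_c: "cmod (c j) = 1" if "j \<in> {1..p}" for j
    proof -
      have "c j \<in> C" using bij_betwE[OF c] that by blast
      then show ?thesis unfolding C_def using a(1) by auto
    qed
    have inj: "inj_on c {1..p}" using c by (simp add: bij_betw_def)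
    define S where "S j = {k \<in> {0..<dim_col F}. a k = c j}" for j
    have part: "indexed_partition p S {0..<dim_col F}"
      using indexed_partition_level_sets[OF c[unfolded C_def]] unfolding S_def .
    define \<eta> where "\<eta> j = x + c j \<cdot>\<^sub>v y" for j
    have null: "\<eta> j \<in> null_space F (S j) - {0\<^sub>v (dim_row F)}" if j: "j \<in> {1..p}" for j
    proof -
      \<comment> \<open>A zero here would make \<open>x\<close> the multiple \<open>- c j\<close> of
        \<open>y\<close>, which \<open>ne\<close> excludes because \<open>- c j\<close> is
        unimodular.\<close>
      have "\<eta> j \<noteq> 0\<^sub>v (dim_row F)"
      proof
        assume 0: "\<eta> j = 0\<^sub>v (dim_row F)"
        have "x $ i = (- c j) * y $ i" if "i < dim_row F" for i
          using arg_cong[OF 0, of "\<lambda>u. u $ i"] that x y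
          by (simp add: \<eta>_def eq_neg_iff_add_eq_0)
        then have "x = (- c j) \<cdot>\<^sub>v y"
          using x y by (intro eq_vecI) auto
        then show False using ne[of "- c j"] norm_c[OF j] by simp
      qed
      moreover have "col F k \<bullet> \<eta> j = 0" if "k \<in> S j" for k
        using a(2)[of k] that x y col[of k]
        by (simp add: S_def \<eta>_def scalar_prod_add_distrib[where n = "dim_row F"])
      ultimately show ?thesis
        using x y unfolding null_space_def by (simp add: \<eta>_def)
    qed
    \<comment> \<open>All quotients equal the direction \<open>y\<close>, so they agree with each
      other, and they are nonzero by \<open>y0\<close>.\<close>
    have slope: "(1 / (c 1 - c j)) \<cdot>\<^sub>v (\<eta> 1 - \<eta> j) = y" if j: "j \<in> {2..p}" for j
    proof -
      have "c 1 - c j \<noteq> 0"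
        using inj_onD[OF inj, of 1 j] j by auto
      moreover have "\<eta> 1 - \<eta> j = (c 1 - c j) \<cdot>\<^sub>v y"
        using x y unfolding \<eta>_def by (intro eq_vecI) (auto simp: algebra_simps)
      ultimately show ?thesis by (simp add: smult_smult_assoc)
    qed
    show ?thesis
    proof (intro exI conjI ballI)
      fix l j assume "l \<in> {2..p}" "j \<in> {2..p}"
      then show "(1 / (c 1 - c l)) \<cdot>\<^sub>v (\<eta> 1 - \<eta> l) = (1 / (c 1 - c j)) \<cdot>\<^sub>v (\<eta> 1 - \<eta> j)"
        "(1 / (c 1 - c j)) \<cdot>\<^sub>v (\<eta> 1 - \<eta> j) \<noteq> 0\<^sub>v (dim_row F)"
        using y0 by (simp_all only: slope not_False_eq_True)
    qed (fact \<open>p \<ge> 1\<close> part null norm_c inj)+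
  qed
qed

theorem theorem4p2:
  fixes d m :: nat and f :: "complex vec list" and F :: "complex mat"
  assumes "d \<ge> 1"
    and "length f = m"
    and "set f \<subseteq> carrier_vec d"
    and "F = mat_of_cols d f"
  shows "phase_retrievable F \<longleftrightarrow>
    (\<forall>(p::nat) S. p \<ge> 1 \<and> indexed_partition p S {0..<m} \<longrightarrow>
      \<not> (\<exists>(\<eta> :: nat \<Rightarrow> complex vec) (c :: nat \<Rightarrow> complex).
            (\<forall>j \<in> {1..p}. \<eta> j \<in> null_space F (S j) - {0\<^sub>v d}) \<and>
            (\<forall>j \<in> {1..p}. cmod (c j) = 1) \<and>
            inj_on c {1..p} \<and>
            (\<forall>l \<in> {2..p}. \<forall>j \<in> {2..p}.
               (1 / (c 1 - c l)) \<cdot>\<^sub>v (\<eta> 1 - \<eta> l) = (1 / (c 1 - c j)) \<cdot>\<^sub>v (\<eta> 1 - \<eta> j) \<and>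
               (1 / (c 1 - c j)) \<cdot>\<^sub>v (\<eta> 1 - \<eta> j) \<noteq> 0\<^sub>v d)))"
proof -
  have dims: "dim_row F = d" "dim_col F = m"
    using assms by auto
  show ?thesis (is "_ \<longleftrightarrow> ?B")
  proof
    assume pr: "phase_retrievable F"
    show ?B
    proof (intro allI impI notI, elim exE conjE, goal_cases)
      case (1 p S \<eta> c)
      then show False
        by (rule phase_retrievable_imp_partition_condition[OF pr, unfolded dims])
    qed
  next
    assume B: ?B
    show "phase_retrievable F"
    proof (rule ccontr)
      assume "\<not> phase_retrievable F"
      from not_phase_retrievable_imp_partition[OF this, unfolded dims] show False
      proof (elim exE conjE, goal_cases)
        case (1 p S \<eta> c)
        show False
          by (rule notE[OF mp[OF spec[OF spec[OF B, of p], of S]]];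
            intro conjI exI[of _ \<eta>] exI[of _ c]; fact 1)
      qed
    qed
  qed
qed

end
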